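(* Let $\theta\in\mathbb R$. 1. For every $\nu\in\mathbb P_\varepsilon$, ${}^*\mathbb Z^{\rm sym}_\nu(\theta)+{}^*\mathbb Z^{\rm sym}_\nu(\theta)\subset{}^*\mathbb Z(\theta|x^{-1})$. 2. For $\sigma=(+,+)$ or $\sigma=(-,-)$ and every $\nu\in\mathbb P_\varepsilon$, ${}^*\mathbb Z^{\rm sym}_\nu(\theta)_\sigma$ is a monoid under addition: ${}^*\mathbb Z^{\rm sym}_\nu(\theta)_\sigma+{}^*\mathbb Z^{\rm sym}_\nu(\theta)_\sigma\subset{}^*\mathbb Z^{\rm sym}_\nu(\theta)_\sigma$.
   Context: Fix a nonprincipal ultrafilter $\mathfrak u$ on $\mathbb N$, and let ${}^*\mathbb Z\subset{}^*\mathbb R$ be the ultrapowers of $\mathbb Z\subset\mathbb R$. Let ${}^*\mathbb R_{\rm fin}$ be the ring of bounded elements, ${}^*\mathbb R_\varepsilon$ its ideal of infinitesimals, and $({}^*\mathbb R_{\rm fin})^\times_+$ the multiplicative group of positive elements that are neither infinite nor infinitesimal. Let $\mathbb P:=({}^*\mathbb R_{>0}\cup\{0\})/({}^*\mathbb R_{\rm fin})^\times_+$; write $\langle x\rangle\in\mathbb P$ for the class of $|x|$. $\mathbb P_\varepsilon\subset\mathbb P$ is the set of classes of positive infinitesimals. For $\theta\in\mathbb R$, ${}^*\mathbb Z(\theta)$ is the group of $n\in{}^*\mathbb Z$ for which there is a (unique) $n^\perp\in{}^*\mathbb Z$ with $\varepsilon(n):=n\theta-n^\perp\in{}^*\mathbb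 R_\varepsilon$; put $\nu(n):=\langle\varepsilon(n)\rangle$. Let $${}^*\mathbb Z(\theta|x^{-1}):=\{0\ne n\in{}^*\mathbb Z(\theta):\ \exists\,C\in\mathbb R_{>0}\text{ with }|\varepsilon(n)|<C|n|^{-1}\}\cup\{0\}.$$ The set of symmetric diophantine approximations is ${}^*\mathbb Z^{\rm sym}(\theta):=\{0\ne n\in{}^*\mathbb Z(\theta): |n|\cdot|\varepsilon(n)|\text{ is neither infinite nor infinitesimal}\}\cup\{0\}$, and for $\nu\in\mathbb P_\varepsilon$, ${}^*\mathbb Z^{\rm sym}_\nu(\theta):=\{n\in{}^*\mathbb Z^{\rm sym}(\theta):\nu(n)=\nu\}\cup\{0\}$. For a sign pair $\sigma\in\{\pm\}^2$, ${}^*\mathbb Z(\theta)_\sigma$ is the monoid consisting of $0$ and those $n\in{}^*\mathbb Z(\theta)$ with $({\rm sign}(n),{\rm sign}(\varepsilon(n)))=\sigma$; ${}^*\mathbb Z^{\rm sym}_\nu(\theta)_\sigma:={}^*\mathbb Z^{\rm sym}_\nu(\theta)\cap{}^*\mathbb Z(\theta)_\sigma$. *)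

theory Defs
  imports Complex_Main "HOL-Algebra.Group"
begin

text \<open>
  An ultrafilter is a \<^typ>\<open>nat filter\<close>; a set \<open>A\<close> belongs to it iff
  \<open>\<forall>\<^sub>F k in U. k \<in> A\<close>. The ultrafilter is an explicit argument of everything below, since
  a type cannot depend on it: an element of an ultrapower is an equivalence class of
  sequences, and the ultrapower itself is a set of such classes.
\<close>

definition ultrafilter :: "nat filter \<Rightarrow> bool" where
  "ultrafilter U \<longleftrightarrow> U \<noteq> bot \<and> (\<forall>P. eventually P U \<or> eventually (\<lambda>k. \<not> P k) U)"

definition nonprincipal_ultrafilter :: "nat filter \<Rightarrow> bool" where
  "nonprincipal_ultrafilter U \<longleftrightarrow> ultrafilter U \<and> (\<forall>k. U \<noteq> principal {k})"

type_synonym hyper = "(nat \<Rightarrow> real) set"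

definition star_class :: "nat filter \<Rightarrow> (nat \<Rightarrow> real) \<Rightarrow> hyper" where
  "star_class U X = {Y. \<forall>\<^sub>F k in U. X k = Y k}"

definition ultrapower :: "nat filter \<Rightarrow> real set \<Rightarrow> hyper set" where
  "ultrapower U A = {star_class U X | X. range X \<subseteq> A}"

abbreviation star_real :: "nat filter \<Rightarrow> hyper set" where
  "star_real U \<equiv> ultrapower U UNIV"

abbreviation star_int :: "nat filter \<Rightarrow> hyper set" where
  "star_int U \<equiv> ultrapower U \<int>"

definition star_of :: "nat filter \<Rightarrow> real \<Rightarrow> hyper" where
  "star_of U r = star_class U (\<lambda>_. r)"

definition star_map :: "(real \<Rightarrow> real) \<Rightarrow> nat filter \<Rightarrow> hyper \<Rightarrow> hyper" where
  "star_map f U x = {Z. \<exists>X\<in>x. \<forall>\<^sub>F k in U. Z k = f (X k)}"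

definition star_map2 :: "(real \<Rightarrow> real \<Rightarrow> real) \<Rightarrow> nat filter \<Rightarrow> hyper \<Rightarrow> hyper \<Rightarrow> hyper" where
  "star_map2 f U x y = {Z. \<exists>X\<in>x. \<exists>Y\<in>y. \<forall>\<^sub>F k in U. Z k = f (X k) (Y k)}"

definition star_rel :: "(real \<Rightarrow> real \<Rightarrow> bool) \<Rightarrow> nat filter \<Rightarrow> hyper \<Rightarrow> hyper \<Rightarrow> bool" where
  "star_rel R U x y \<longleftrightarrow> (\<exists>X\<in>x. \<exists>Y\<in>y. \<forall>\<^sub>F k in U. R (X k) (Y k))"

abbreviation star_add :: "nat filter \<Rightarrow> hyper \<Rightarrow> hyper \<Rightarrow> hyper" where
  "star_add \<equiv> star_map2 (+)"

abbreviation star_diff :: "nat filter \<Rightarrow> hyper \<Rightarrow> hyper \<Rightarrow> hyper" where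
  "star_diff \<equiv> star_map2 (-)"

abbreviation star_mult :: "nat filter \<Rightarrow> hyper \<Rightarrow> hyper \<Rightarrow> hyper" where
  "star_mult \<equiv> star_map2 (*)"

abbreviation star_inverse :: "nat filter \<Rightarrow> hyper \<Rightarrow> hyper" where
  "star_inverse \<equiv> star_map inverse"

abbreviation star_abs :: "nat filter \<Rightarrow> hyper \<Rightarrow> hyper" where
  "star_abs \<equiv> star_map abs"

abbreviation star_less :: "nat filter \<Rightarrow> hyper \<Rightarrow> hyper \<Rightarrow> bool" where
  "star_less \<equiv> star_rel (<)"

abbreviation star_le :: "nat filter \<Rightarrow> hyper \<Rightarrow> hyper \<Rightarrow> bool" where
  "star_le \<equiv> star_rel (\<le>)"

lemma star_map_class: "star_map f U (star_class U X) = star_class U (\<lambda>k. f (X k))"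
proof (rule Set.set_eqI, rule iffI)
  fix Z assume "Z \<in> star_map f U (star_class U X)"
  then obtain Y where "\<forall>\<^sub>F k in U. X k = Y k" "\<forall>\<^sub>F k in U. Z k = f (Y k)"
    by (auto simp: star_map_def star_class_def)
  then have "\<forall>\<^sub>F k in U. f (X k) = Z k" by eventually_elim simp
  then show "Z \<in> star_class U (\<lambda>k. f (X k))" by (simp add: star_class_def)
next
  fix Z assume "Z \<in> star_class U (\<lambda>k. f (X k))"
  then have "\<forall>\<^sub>F k in U. Z k = f (X k)" by (simp add: star_class_def eq_commute)
  moreover have "X \<in> star_class U X" by (simp add: star_class_def)
  ultimately show "Z \<in> star_map f U (star_class U X)" by (auto simp: star_map_def)
qed

lemma star_map2_class:
  "star_map2 f U (star_class U X) (star_class U Y) = star_class U (\<lambda>k. f (X k) (Y k))"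
proof (rule Set.set_eqI, rule iffI)
  fix Z assume "Z \<in> star_map2 f U (star_class U X) (star_class U Y)"
  then obtain X' Y' where "\<forall>\<^sub>F k in U. X k = X' k" "\<forall>\<^sub>F k in U. Y k = Y' k"
      "\<forall>\<^sub>F k in U. Z k = f (X' k) (Y' k)"
    by (auto simp: star_map2_def star_class_def)
  then have "\<forall>\<^sub>F k in U. f (X k) (Y k) = Z k" by eventually_elim simp
  then show "Z \<in> star_class U (\<lambda>k. f (X k) (Y k))" by (simp add: star_class_def)
next
  fix Z assume "Z \<in> star_class U (\<lambda>k. f (X k) (Y k))"
  then have "\<forall>\<^sub>F k in U. Z k = f (X k) (Y k)" by (simp add: star_class_def eq_commute)
  moreover have "X \<in> star_class U X" "Y \<in> star_class U Y" by (simp_all add: star_class_def)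
  ultimately show "Z \<in> star_map2 f U (star_class U X) (star_class U Y)"
    by (auto simp: star_map2_def)
qed

lemma star_rel_class:
  "star_rel R U (star_class U X) (star_class U Y) \<longleftrightarrow> (\<forall>\<^sub>F k in U. R (X k) (Y k))"
  unfolding star_rel_def star_class_def
proof (rule iffI; clarsimp)
  fix X' Y'
  assume "\<forall>\<^sub>F k in U. X k = X' k" "\<forall>\<^sub>F k in U. Y k = Y' k" "\<forall>\<^sub>F k in U. R (X' k) (Y' k)"
  then show "\<forall>\<^sub>F k in U. R (X k) (Y k)" by eventually_elim simp
next
  assume "\<forall>\<^sub>F k in U. R (X k) (Y k)"
  then show "\<exists>X'. (\<forall>\<^sub>F k in U. X k = X' k) \<and>
      (\<exists>Y'. (\<forall>\<^sub>F k in U. Y k = Y' k) \<and> (\<forall>\<^sub>F k in U. R (X' k) (Y' k)))"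
    by (intro exI[of _ X] exI[of _ Y] conjI) simp_all
qed

lemma star_class_eq_iff: "star_class U X = star_class U Y \<longleftrightarrow> (\<forall>\<^sub>F k in U. X k = Y k)"
proof
  assume "star_class U X = star_class U Y"
  moreover have "Y \<in> star_class U Y" by (simp add: star_class_def)
  ultimately have "Y \<in> star_class U X" by simp
  then show "\<forall>\<^sub>F k in U. X k = Y k" by (simp add: star_class_def)
next
  assume XY: "\<forall>\<^sub>F k in U. X k = Y k"
  have "(\<forall>\<^sub>F k in U. X k = Z k) \<longleftrightarrow> (\<forall>\<^sub>F k in U. Y k = Z k)" for Z
    by (rule eventually_cong[OF XY]) simp
  then show "star_class U X = star_class U Y" by (simp add: star_class_def)
qed

definition star_fin :: "nat filter \<Rightarrow> hyper set" where
  "star_fin U = {x \<in> star_real U. \<exists>r>0. star_le U (star_abs U x) (star_of U r)}"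

definition star_eps :: "nat filter \<Rightarrow> hyper set" where
  "star_eps U = {x \<in> star_real U. \<forall>r>0. star_less U (star_abs U x) (star_of U r)}"

definition star_fin_units_pos :: "nat filter \<Rightarrow> hyper set" where
  "star_fin_units_pos U = {x \<in> star_fin U - star_eps U. star_less U (star_of U 0) x}"

text \<open>
  \<open>star_mag U x\<close> is the orbit of \<open>\<bar>x\<bar>\<close> under multiplication by the positive elements that are
  neither infinite nor infinitesimal.
\<close>

definition star_mag :: "nat filter \<Rightarrow> hyper \<Rightarrow> hyper set" where
  "star_mag U x = {star_mult U c (star_abs U x) | c. c \<in> star_fin_units_pos U}"

definition star_P :: "nat filter \<Rightarrow> hyper set set" where
  "star_P U = star_mag U ` {x \<in> star_real U. star_less U (star_of U 0) x \<or> x = star_of U 0}"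

definition star_P_eps :: "nat filter \<Rightarrow> hyper set set" where
  "star_P_eps U = {\<nu> \<in> star_P U. \<exists>x \<in> star_eps U. star_less U (star_of U 0) x \<and> \<nu> = star_mag U x}"

definition dioph :: "nat filter \<Rightarrow> real \<Rightarrow> hyper set" where
  "dioph U \<theta> = {n \<in> star_int U. \<exists>m \<in> star_int U.
     star_diff U (star_mult U n (star_of U \<theta>)) m \<in> star_eps U}"

definition perp :: "nat filter \<Rightarrow> real \<Rightarrow> hyper \<Rightarrow> hyper" where
  "perp U \<theta> n = (THE m. m \<in> star_int U \<and>
     star_diff U (star_mult U n (star_of U \<theta>)) m \<in> star_eps U)"

definition err :: "nat filter \<Rightarrow> real \<Rightarrow> hyper \<Rightarrow> hyper" where
  "err U \<theta> n = star_diff U (star_mult U n (star_of U \<theta>)) (perp U \<theta> n)"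

lemma perp_unique:
  assumes "n \<in> dioph U \<theta>"
  shows "\<exists>!m. m \<in> star_int U \<and> star_diff U (star_mult U n (star_of U \<theta>)) m \<in> star_eps U"
proof -
  obtain m where m: "m \<in> star_int U"
      "star_diff U (star_mult U n (star_of U \<theta>)) m \<in> star_eps U"
    and n: "n \<in> star_int U"
    using assms by (auto simp: dioph_def)
  show ?thesis
  proof (rule ex1I[of _ m])
    fix m' assume m': "m' \<in> star_int U \<and> star_diff U (star_mult U n (star_of U \<theta>)) m' \<in> star_eps U"
    obtain N where N: "n = star_class U N" using n by (auto simp: ultrapower_def)
    obtain M where M: "m = star_class U M" "\<And>k. M k \<in> \<int>"
      using m(1) by (auto simp: ultrapower_def)
    obtain M' where M': "m' = star_class U M'" "\<And>k. M' k \<in> \<int>"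
      using m' by (auto simp: ultrapower_def)
    have half: "\<forall>\<^sub>F k in U. \<bar>N k * \<theta> - L k\<bar> < 1/2"
      if "star_diff U (star_mult U n (star_of U \<theta>)) (star_class U L) \<in> star_eps U" for L
    proof -
      have "\<forall>r>0. star_less U (star_abs U (star_class U (\<lambda>k. N k * \<theta> - L k))) (star_of U r)"
        using that by (simp add: star_eps_def N star_of_def star_map2_class)
      then have "star_less U (star_abs U (star_class U (\<lambda>k. N k * \<theta> - L k))) (star_of U (1/2))"
        by (elim allE[of _ "1/2"]) simp
      then show ?thesis by (simp add: star_of_def star_map_class star_rel_class)
    qed
    have "\<forall>\<^sub>F k in U. \<bar>N k * \<theta> - M k\<bar> < 1/2" "\<forall>\<^sub>F k in U. \<bar>N k * \<theta> - M' k\<bar> < 1/2"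
      using half[of M] half[of M'] m(2) m' M(1) M'(1) by blast+
    then have "\<forall>\<^sub>F k in U. M' k = M k"
    proof eventually_elim
      case (elim k)
      have "M' k - M k \<in> \<int>" using M(2) M'(2) by auto
      moreover have "\<bar>M' k - M k\<bar> < 1" using elim by linarith
      ultimately have "M' k - M k = 0" using Ints_nonzero_abs_less1 by blast
      then show ?case by simp
    qed
    then show "m' = m" by (simp add: M M' star_class_eq_iff)
  qed (use m in simp)
qed

definition dioph_inv :: "nat filter \<Rightarrow> real \<Rightarrow> hyper set" where
  "dioph_inv U \<theta> = {n \<in> dioph U \<theta>. n \<noteq> star_of U 0 \<and>
     (\<exists>C>0. star_less U (star_abs U (err U \<theta> n))
                (star_mult U (star_of U C) (star_inverse U (star_abs U n))))} \<union> {star_of U 0}"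

definition dioph_sym :: "nat filter \<Rightarrow> real \<Rightarrow> hyper set" where
  "dioph_sym U \<theta> = {n \<in> dioph U \<theta>. n \<noteq> star_of U 0 \<and>
     star_mult U (star_abs U n) (star_abs U (err U \<theta> n)) \<in> star_fin U - star_eps U} \<union> {star_of U 0}"

definition dioph_sym_at :: "nat filter \<Rightarrow> real \<Rightarrow> hyper set \<Rightarrow> hyper set" where
  "dioph_sym_at U \<theta> \<nu> = {n \<in> dioph_sym U \<theta>. star_mag U (err U \<theta> n) = \<nu>} \<union> {star_of U 0}"

datatype sign = Pos | Neg

fun has_sign :: "nat filter \<Rightarrow> sign \<Rightarrow> hyper \<Rightarrow> bool" where
  "has_sign U Pos x = star_less U (star_of U 0) x"
| "has_sign U Neg x = star_less U x (star_of U 0)"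

definition dioph_signed :: "nat filter \<Rightarrow> real \<Rightarrow> sign \<times> sign \<Rightarrow> hyper set" where
  "dioph_signed U \<theta> \<sigma> = {n \<in> dioph U \<theta>. has_sign U (fst \<sigma>) n \<and> has_sign U (snd \<sigma>) (err U \<theta> n)}
     \<union> {star_of U 0}"

definition dioph_sym_at_signed ::
    "nat filter \<Rightarrow> real \<Rightarrow> hyper set \<Rightarrow> sign \<times> sign \<Rightarrow> hyper set" where
  "dioph_sym_at_signed U \<theta> \<nu> \<sigma> = dioph_sym_at U \<theta> \<nu> \<inter> dioph_signed U \<theta> \<sigma>"

definition star_sumset :: "nat filter \<Rightarrow> hyper set \<Rightarrow> hyper set \<Rightarrow> hyper set" where
  "star_sumset U A B = {star_add U m n | m n. m \<in> A \<and> n \<in> B}"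

end

theory Submission
  imports Defs
begin

text \<open>
  Two nonzero symmetric approximations \<open>m\<close>, \<open>n\<close> with \<open>\<nu>(m) = \<nu>(n)\<close> have errors of the same order
  of magnitude, so all four products \<open>\<bar>m\<bar>\<bar>\<epsilon>(m)\<bar>\<close>, \<open>\<bar>m\<bar>\<bar>\<epsilon>(n)\<bar>\<close>, \<open>\<bar>n\<bar>\<bar>\<epsilon>(m)\<bar>\<close>, \<open>\<bar>n\<bar>\<bar>\<epsilon>(n)\<bar>\<close> are
  bounded, and hence so is \<open>\<bar>m + n\<bar>\<bar>\<epsilon>(m + n)\<bar>\<close>. If moreover the signs of \<open>m\<close>, \<open>n\<close> and of
  \<open>\<epsilon>(m)\<close>, \<open>\<epsilon>(n)\<close> agree, no cancellation occurs: \<open>\<bar>m + n\<bar>\<bar>\<epsilon>(m + n)\<bar> \<ge> \<bar>m\<bar>\<bar>\<epsilon>(m)\<bar>\<close> is not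
  infinitesimal, and \<open>\<bar>\<epsilon>(m + n)\<bar>\<close> has the same magnitude as \<open>\<bar>\<epsilon>(m)\<bar>\<close>.
\<close>

section \<open>Infinitesimal and appreciable classes in terms of representatives\<close>

lemma eventually_not_iff_ultrafilter:
  assumes "ultrafilter U"
  shows "(\<forall>\<^sub>F k in U. \<not> P k) \<longleftrightarrow> \<not> (\<forall>\<^sub>F k in U. P k)"
proof
  assume *: "\<forall>\<^sub>F k in U. \<not> P k"
  show "\<not> (\<forall>\<^sub>F k in U. P k)"
  proof
    assume "\<forall>\<^sub>F k in U. P k"
    with * have "\<forall>\<^sub>F k in U. False" by eventually_elim simp
    then show False using assms by (simp add: ultrafilter_def trivial_limit_def)
  qed
qed (use assms in \<open>auto simp: ultrafilter_def\<close>)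

lemma star_class_in_star_real [simp]: "star_class U X \<in> star_real U"
  by (auto simp: ultrapower_def)

lemma star_class_in_star_eps_iff:
  "star_class U X \<in> star_eps U \<longleftrightarrow> (\<forall>r>0. \<forall>\<^sub>F k in U. \<bar>X k\<bar> < r)"
  by (simp add: star_eps_def star_of_def star_map_class star_rel_class)

text \<open>Failing to be infinitesimal means that \<open>\<bar>X k\<bar> < a\<close> is not
  eventually true for some standard a > 0. The ultrafilter property turns this failure into the
  positive statement that a is eventually a lower bound.\<close>

lemma star_class_appreciable_iff:
  assumes "ultrafilter U"
  shows "star_class U X \<in> star_fin U - star_eps U \<longleftrightarrow>
    (\<exists>a>0. \<exists>b>0. \<forall>\<^sub>F k in U. a \<le> \<bar>X k\<bar> \<and> \<bar>X k\<bar> \<le> b)"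
proof -
  have "(\<forall>\<^sub>F k in U. a \<le> \<bar>X k\<bar>) \<longleftrightarrow> \<not> (\<forall>\<^sub>F k in U. \<bar>X k\<bar> < a)" for a
    using eventually_not_iff_ultrafilter[OF assms, of "\<lambda>k. \<bar>X k\<bar> < a"] by (simp add: not_less)
  then show ?thesis
    by (auto simp: star_class_in_star_eps_iff star_fin_def star_of_def star_map_class
        star_rel_class eventually_conj_iff)
qed

lemma star_class_in_star_fin_units_pos_iff:
  assumes "ultrafilter U"
  shows "star_class U X \<in> star_fin_units_pos U \<longleftrightarrow>
    (\<exists>a>0. \<exists>b>0. \<forall>\<^sub>F k in U. a \<le> X k \<and> X k \<le> b)" (is "?L \<longleftrightarrow> ?R")
proof
  assume ?L
  then obtain a b where ab: "a > 0" "b > 0" "\<forall>\<^sub>F k in U. a \<le> \<bar>X k\<bar> \<and> \<bar>X k\<bar> \<le> b"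
    and pos: "\<forall>\<^sub>F k in U. 0 < X k"
    using star_class_appreciable_iff[OF assms, of X]
    by (auto simp: star_fin_units_pos_def star_of_def star_rel_class)
  from ab(3) pos have "\<forall>\<^sub>F k in U. a \<le> X k \<and> X k \<le> b" by eventually_elim simp
  with ab show ?R by blast
next
  assume ?R
  then obtain a b where ab: "a > 0" "b > 0" and ev: "\<forall>\<^sub>F k in U. a \<le> X k \<and> X k \<le> b" by blast
  have "\<forall>\<^sub>F k in U. a \<le> \<bar>X k\<bar> \<and> \<bar>X k\<bar> \<le> b" using ev by eventually_elim (use ab in simp)
  moreover have "\<forall>\<^sub>F k in U. 0 < X k" using ev by eventually_elim (use ab in simp)
  ultimately show ?L
    using ab star_class_appreciable_iff[OF assms, of X]
    by (auto simp: star_fin_units_pos_def star_of_def star_rel_class)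
qed

lemma star_fin_units_posE:
  assumes "ultrafilter U" "c \<in> star_fin_units_pos U"
  obtains C a b where "c = star_class U C" "a > 0" "b > 0" "\<forall>\<^sub>F k in U. a \<le> C k \<and> C k \<le> b"
proof -
  obtain C where "c = star_class U C"
    using assms(2) by (auto simp: star_fin_units_pos_def star_fin_def ultrapower_def)
  then show ?thesis
    using that assms star_class_in_star_fin_units_pos_iff[OF assms(1), of C] by blast
qed

section \<open>Equality of magnitudes as a two-sided comparison of representatives\<close>

definition same_order :: "nat filter \<Rightarrow> (nat \<Rightarrow> real) \<Rightarrow> (nat \<Rightarrow> real) \<Rightarrow> bool" where
  "same_order U X Y \<longleftrightarrow> (\<exists>a>0. \<exists>b>0. \<forall>\<^sub>F k in U. a * \<bar>X k\<bar> \<le> \<bar>Y k\<bar> \<and> \<bar>Y k\<bar> \<le> b * \<bar>X k\<bar>)"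

lemma same_order_sym:
  assumes "same_order U X Y"
  shows "same_order U Y X"
proof -
  obtain a b where ab: "a > 0" "b > 0"
    and ev: "\<forall>\<^sub>F k in U. a * \<bar>X k\<bar> \<le> \<bar>Y k\<bar> \<and> \<bar>Y k\<bar> \<le> b * \<bar>X k\<bar>"
    using assms by (auto simp: same_order_def)
  have "\<forall>\<^sub>F k in U. 1/b * \<bar>Y k\<bar> \<le> \<bar>X k\<bar> \<and> \<bar>X k\<bar> \<le> 1/a * \<bar>Y k\<bar>"
    using ev by eventually_elim (use ab in \<open>simp add: field_simps\<close>)
  moreover have "1/a > 0" "1/b > 0" using ab by auto
  ultimately show ?thesis unfolding same_order_def by blast
qed

text \<open>The quotient of \<bar>Y\<bar> by \<bar>X\<bar> lies between positive standard bounds, so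
  it can be absorbed into the unit multiplying \<bar>Y\<bar>. Since \<open>same_order\<close> is
  symmetric, one inclusion suffices.\<close>

lemma star_mag_subset_if_same_order:
  assumes U: "ultrafilter U" and "same_order U X Y"
  shows "star_mag U (star_class U Y) \<subseteq> star_mag U (star_class U X)"
proof
  fix z assume "z \<in> star_mag U (star_class U Y)"
  then obtain C c d where cd: "c > 0" "d > 0" and C: "\<forall>\<^sub>F k in U. c \<le> C k \<and> C k \<le> d"
    and z: "z = star_class U (\<lambda>k. C k * \<bar>Y k\<bar>)"
    by (auto simp: star_mag_def star_map_class star_map2_class elim!: star_fin_units_posE[OF U])
  obtain a b where ab: "a > 0" "b > 0"
    and ev: "\<forall>\<^sub>F k in U. a * \<bar>X k\<bar> \<le> \<bar>Y k\<bar> \<and> \<bar>Y k\<bar> \<le> b * \<bar>X k\<bar>"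
    using assms by (auto simp: same_order_def)
  \<comment> \<open>Where X vanishes, the upper bound in \<open>ev\<close> makes Y vanish too, so
    any value of Q satisfies the equation. The default a keeps Q within its bounds;
    \<open>max a b\<close> is used because a \<le> b is not given.\<close>
  define Q where "Q k = (if X k = 0 then a else \<bar>Y k\<bar> / \<bar>X k\<bar>)" for k
  have Q: "\<forall>\<^sub>F k in U. a \<le> Q k \<and> Q k \<le> max a b \<and> \<bar>Y k\<bar> = Q k * \<bar>X k\<bar>"
    using ev by eventually_elim (auto simp: Q_def field_simps le_max_iff_disj)
  from Q C have "\<forall>\<^sub>F k in U. c * a \<le> C k * Q k \<and> C k * Q k \<le> d * max a b"
    by eventually_elim (use ab cd in \<open>auto intro!: mult_mono\<close>)
  moreover have "c * a > 0" "d * max a b > 0" using ab cd by (auto simp: less_max_iff_disj)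
  ultimately have "star_class U (\<lambda>k. C k * Q k) \<in> star_fin_units_pos U"
    using star_class_in_star_fin_units_pos_iff[OF U] by blast
  moreover have "\<forall>\<^sub>F k in U. C k * \<bar>Y k\<bar> = C k * Q k * \<bar>X k\<bar>"
    using Q by eventually_elim simp
  then have "z = star_mult U (star_class U (\<lambda>k. C k * Q k)) (star_abs U (star_class U X))"
    by (simp add: z star_map_class star_map2_class star_class_eq_iff)
  ultimately show "z \<in> star_mag U (star_class U X)" by (auto simp: star_mag_def)
qed

text \<open>The unit 1 puts \<bar>Y\<bar> into its own orbit. If the orbits agree, \<bar>Y\<bar> is
  therefore a unit multiple of \<bar>X\<bar>, and the standard bounds on that unit are the constants
  of \<open>same_order\<close>.\<close>

lemma star_mag_eq_iff:
  assumes U: "ultrafilter U"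
  shows "star_mag U (star_class U X) = star_mag U (star_class U Y) \<longleftrightarrow> same_order U X Y"
proof
  assume eq: "star_mag U (star_class U X) = star_mag U (star_class U Y)"
  have "star_class U (\<lambda>_. 1) \<in> star_fin_units_pos U"
    using star_class_in_star_fin_units_pos_iff[OF U, of "\<lambda>_. 1"] by (auto intro!: exI[of _ 1])
  moreover have "star_class U (\<lambda>k. \<bar>Y k\<bar>)
      = star_mult U (star_class U (\<lambda>_. 1)) (star_abs U (star_class U Y))"
    by (simp add: star_map_class star_map2_class)
  ultimately have "star_class U (\<lambda>k. \<bar>Y k\<bar>) \<in> star_mag U (star_class U X)"
    unfolding eq by (auto simp: star_mag_def)
  then obtain C c d where cd: "c > 0" "d > 0" and C: "\<forall>\<^sub>F k in U. c \<le> C k \<and> C k \<le> d"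
    and Y: "\<forall>\<^sub>F k in U. \<bar>Y k\<bar> = C k * \<bar>X k\<bar>"
    by (auto simp: star_mag_def star_map_class star_map2_class star_class_eq_iff
        elim!: star_fin_units_posE[OF U])
  from C Y have "\<forall>\<^sub>F k in U. c * \<bar>X k\<bar> \<le> \<bar>Y k\<bar> \<and> \<bar>Y k\<bar> \<le> d * \<bar>X k\<bar>"
    by eventually_elim (auto intro!: mult_right_mono)
  with cd show "same_order U X Y" by (auto simp: same_order_def)
next
  assume "same_order U X Y"
  then show "star_mag U (star_class U X) = star_mag U (star_class U Y)"
    using star_mag_subset_if_same_order[OF U] same_order_sym by blast
qed

section \<open>Computation and additivity of the error\<close>

lemma err_eqI:
  assumes "n \<in> star_int U" "m \<in> star_int U"
    and "star_diff U (star_mult U n (star_of U \<theta>)) m \<in> star_eps U"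
  shows "n \<in> dioph U \<theta>" "err U \<theta> n = star_diff U (star_mult U n (star_of U \<theta>)) m"
proof -
  show n: "n \<in> dioph U \<theta>" using assms by (auto simp: dioph_def)
  have "perp U \<theta> n = m"
    unfolding perp_def by (rule the1_equality[OF perp_unique[OF n]]) (use assms in simp)
  then show "err U \<theta> n = star_diff U (star_mult U n (star_of U \<theta>)) m" by (simp add: err_def)
qed

text \<open>Replaces the definite description behind \<open>err\<close> by an explicit integer
  sequence M, so that later arguments are inequalities between real sequences.\<close>

lemma diophE:
  assumes "n \<in> dioph U \<theta>"
  obtains N M where "range N \<subseteq> \<int>" "range M \<subseteq> \<int>" "n = star_class U N"
    "err U \<theta> n = star_class U (\<lambda>k. N k * \<theta> - M k)"
    "\<And>r. r > 0 \<Longrightarrow> \<forall>\<^sub>F k in U. \<bar>N k * \<theta> - M k\<bar> < r"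
proof -
  obtain m where n: "n \<in> star_int U" and m: "m \<in> star_int U"
    and d: "star_diff U (star_mult U n (star_of U \<theta>)) m \<in> star_eps U"
    using assms by (auto simp: dioph_def)
  obtain N where N: "n = star_class U N" "range N \<subseteq> \<int>" using n by (auto simp: ultrapower_def)
  obtain M where M: "m = star_class U M" "range M \<subseteq> \<int>" using m by (auto simp: ultrapower_def)
  have eq: "star_diff U (star_mult U n (star_of U \<theta>)) m = star_class U (\<lambda>k. N k * \<theta> - M k)"
    by (simp add: N M star_of_def star_map2_class)
  have "err U \<theta> n = star_class U (\<lambda>k. N k * \<theta> - M k)"
    using err_eqI(2)[OF n m d] by (simp only: eq)
  moreover have "\<forall>r>0. \<forall>\<^sub>F k in U. \<bar>N k * \<theta> - M k\<bar> < r"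
    using d unfolding eq star_class_in_star_eps_iff .
  ultimately show ?thesis using that N M by blast
qed

lemma dioph_classE:
  assumes "n \<in> dioph U \<theta>"
  obtains N E where "n = star_class U N" "err U \<theta> n = star_class U E"
  using assms by (rule diophE) blast

text \<open>The sum of the two nearest integers leaves an infinitesimal remainder for m + n, so by
  uniqueness it is the nearest integer of m + n. Hence the errors add exactly.\<close>

lemma dioph_add:
  assumes "m \<in> dioph U \<theta>" "n \<in> dioph U \<theta>"
  shows "star_add U m n \<in> dioph U \<theta>"
    and "err U \<theta> (star_add U m n) = star_add U (err U \<theta> m) (err U \<theta> n)"
proof -
  obtain N M where NM: "range N \<subseteq> \<int>" "range M \<subseteq> \<int>" "m = star_class U N"
    "err U \<theta> m = star_class U (\<lambda>k. N k * \<theta> - M k)"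
    "\<And>r. r > 0 \<Longrightarrow> \<forall>\<^sub>F k in U. \<bar>N k * \<theta> - M k\<bar> < r"
    using diophE[OF assms(1)] by blast
  obtain N' M' where NM': "range N' \<subseteq> \<int>" "range M' \<subseteq> \<int>" "n = star_class U N'"
    "err U \<theta> n = star_class U (\<lambda>k. N' k * \<theta> - M' k)"
    "\<And>r. r > 0 \<Longrightarrow> \<forall>\<^sub>F k in U. \<bar>N' k * \<theta> - M' k\<bar> < r"
    using diophE[OF assms(2)] by blast
  let ?s = "star_class U (\<lambda>k. N k + N' k)" and ?t = "star_class U (\<lambda>k. M k + M' k)"
  have int: "?s \<in> star_int U" "?t \<in> star_int U"
    using NM(1,2) NM'(1,2) by (auto simp: ultrapower_def image_subset_iff)
  have eq: "star_diff U (star_mult U ?s (star_of U \<theta>)) ?t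
      = star_class U (\<lambda>k. (N k + N' k) * \<theta> - (M k + M' k))"
    by (simp add: star_of_def star_map2_class)
  have "\<forall>\<^sub>F k in U. \<bar>(N k + N' k) * \<theta> - (M k + M' k)\<bar> < r" if "r > 0" for r
    using NM(5)[OF half_gt_zero[OF that]] NM'(5)[OF half_gt_zero[OF that]]
  proof eventually_elim
    case (elim k)
    have "(N k + N' k) * \<theta> - (M k + M' k) = (N k * \<theta> - M k) + (N' k * \<theta> - M' k)"
      by (simp add: algebra_simps)
    with elim show ?case by linarith
  qed
  then have "star_diff U (star_mult U ?s (star_of U \<theta>)) ?t \<in> star_eps U"
    unfolding eq star_class_in_star_eps_iff by blast
  note e = err_eqI[OF int this]
  have s: "star_add U m n = ?s" by (simp add: NM NM' star_map2_class)
  show "star_add U m n \<in> dioph U \<theta>" unfolding s by (rule e)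
  show "err U \<theta> (star_add U m n) = star_add U (err U \<theta> m) (err U \<theta> n)"
    unfolding NM(4) NM'(4) star_map2_class unfolding s e(2) eq by (simp add: algebra_simps)
qed

section \<open>Bounds on the product of an approximation with its error\<close>

lemma dioph_invI:
  assumes U: "ultrafilter U" and n: "n \<in> dioph U \<theta>"
    and N: "n = star_class U N" and E: "err U \<theta> n = star_class U E"
    and b: "\<forall>\<^sub>F k in U. \<bar>N k\<bar> * \<bar>E k\<bar> < b"
  shows "n \<in> dioph_inv U \<theta>"
proof (cases "n = star_of U 0")
  case False
  \<comment> \<open>A nonzero class has an eventually nonzero representative because U is an
    ultrafilter; this permits the division by \<bar>N k\<bar>. The constant \<open>max b 1\<close>
    is visibly positive, as \<open>dioph_inv\<close> demands.\<close>
  then have "\<forall>\<^sub>F k in U. N k \<noteq> 0"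
    by (simp add: N star_of_def star_class_eq_iff eventually_not_iff_ultrafilter[OF U])
  with b have "\<forall>\<^sub>F k in U. \<bar>E k\<bar> < max b 1 * inverse \<bar>N k\<bar>"
    by eventually_elim (auto simp: field_simps less_max_iff_disj)
  \<comment> \<open>\<open>E\<close> has to be unfolded before \<open>N\<close>: rewriting n first
    would also change it inside \<open>err U \<theta> n\<close>.\<close>
  then have "star_less U (star_abs U (err U \<theta> n))
      (star_mult U (star_of U (max b 1)) (star_inverse U (star_abs U n)))"
    unfolding E unfolding N by (simp add: star_of_def star_map_class star_map2_class star_rel_class)
  moreover have "max b 1 > 0" by simp
  ultimately show ?thesis using n False unfolding dioph_inv_def by blast
qed (simp add: dioph_inv_def)

lemma dioph_symE:
  assumes U: "ultrafilter U" and "n \<in> dioph_sym U \<theta>" "n \<noteq> star_of U 0"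
  obtains N E a b where "n \<in> dioph U \<theta>" "n = star_class U N" "err U \<theta> n = star_class U E"
    "a > 0" "b > 0" "\<forall>\<^sub>F k in U. a \<le> \<bar>N k\<bar> * \<bar>E k\<bar> \<and> \<bar>N k\<bar> * \<bar>E k\<bar> \<le> b"
proof -
  have n: "n \<in> dioph U \<theta>"
    and fin: "star_mult U (star_abs U n) (star_abs U (err U \<theta> n)) \<in> star_fin U - star_eps U"
    using assms by (auto simp: dioph_sym_def)
  obtain N E where NE: "n = star_class U N" "err U \<theta> n = star_class U E"
    using n by (rule dioph_classE)
  have "star_class U (\<lambda>k. \<bar>N k\<bar> * \<bar>E k\<bar>) \<in> star_fin U - star_eps U"
    using fin unfolding NE(2) unfolding NE(1) by (simp add: star_map_class star_map2_class)
  then show ?thesis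
    using that n NE star_class_appreciable_iff[OF U, of "\<lambda>k. \<bar>N k\<bar> * \<bar>E k\<bar>"]
    by (auto simp: abs_mult)
qed

lemma dioph_sym_subset_dioph_inv:
  assumes U: "ultrafilter U"
  shows "dioph_sym U \<theta> \<subseteq> dioph_inv U \<theta>"
proof
  fix n assume n: "n \<in> dioph_sym U \<theta>"
  show "n \<in> dioph_inv U \<theta>"
  proof (cases "n = star_of U 0")
    case False
    obtain N E a b where NE: "n \<in> dioph U \<theta>" "n = star_class U N"
      "err U \<theta> n = star_class U E" and "a > 0" "b > 0" and ev: "\<forall>\<^sub>F k in U. a \<le> \<bar>N k\<bar> * \<bar>E k\<bar> \<and> \<bar>N k\<bar> * \<bar>E k\<bar> \<le> b"
      by (rule dioph_symE[OF U n False])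
    have "\<forall>\<^sub>F k in U. \<bar>N k\<bar> * \<bar>E k\<bar> < b + 1" using ev by eventually_elim linarith
    then show ?thesis by (rule dioph_invI[OF U NE])
  qed (simp add: dioph_inv_def)
qed

section \<open>Sums of two symmetric approximations of equal magnitude\<close>

lemma dioph_sym_at_subset_dioph_sym: "dioph_sym_at U \<theta> \<nu> \<subseteq> dioph_sym U \<theta>"
  by (auto simp: dioph_sym_at_def dioph_sym_def)

text \<open>The type \<open>hyper\<close> contains all sets of sequences, and the algebraic laws are
  proved for classes of sequences. This supplies the representatives needed for neutrality of 0 and
  associativity.\<close>

lemma star_class_if_dioph_sym: "n \<in> dioph_sym U \<theta> \<Longrightarrow> \<exists>N. n = star_class U N"
  by (auto simp: dioph_sym_def dioph_def ultrapower_def star_of_def)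

lemma star_add_zero:
  assumes "n \<in> dioph_sym U \<theta>"
  shows "star_add U (star_of U 0) n = n" "star_add U n (star_of U 0) = n"
  using star_class_if_dioph_sym[OF assms] by (auto simp: star_of_def star_map2_class)

text \<open>Comparability of the errors reduces the cross terms to the diagonal ones: N * E' is at
  most b times N * E, and N' * E is at most 1/a times N' * E'. It is applied to absolute
  values.\<close>

lemma sum_products_le:
  fixes N N' E E' :: real
  assumes "a > 0" "b > 0" "N * E \<le> c" "N' * E' \<le> d" "a * E \<le> E'" "E' \<le> b * E" "N \<ge> 0" "N' \<ge> 0"
  shows "(N + N') * (E + E') \<le> (1 + b) * c + (1 + 1/a) * d"
proof -
  have "N * E' \<le> b * (N * E)" using mult_left_mono[OF assms(6,7)] by (simp add: algebra_simps)
  also have "\<dots> \<le> b * c" using assms by simp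
  finally have 1: "N * E' \<le> b * c" .
  have "a * (N' * E) \<le> N' * E'" using mult_left_mono[OF assms(5,8)] by (simp add: algebra_simps)
  then have "a * (N' * E) \<le> d" using assms by linarith
  then have 2: "N' * E \<le> 1/a * d" using assms by (simp add: field_simps)
  show ?thesis using 1 2 assms(3,4) by (simp add: algebra_simps)
qed

text \<open>The common core of both claims. The bound c yields boundedness of the product for m + n;
  the bounds a and b serve the signed case, where a keeps that product away from 0 and b controls
  the magnitude of the summed error.\<close>

lemma dioph_sym_at_pairE:
  assumes U: "ultrafilter U"
    and m: "m \<in> dioph_sym_at U \<theta> \<nu>" "m \<noteq> star_of U 0"
    and n: "n \<in> dioph_sym_at U \<theta> \<nu>" "n \<noteq> star_of U 0"
  obtains N E N' E' a b c where
    "star_add U m n \<in> dioph U \<theta>" "m = star_class U N" "n = star_class U N'"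
    "err U \<theta> m = star_class U E" "err U \<theta> n = star_class U E'"
    "err U \<theta> (star_add U m n) = star_class U (\<lambda>k. E k + E' k)"
    "star_mag U (star_class U E) = \<nu>"
    "a > 0" "b > 0" "c > 0"
    "\<forall>\<^sub>F k in U. a \<le> \<bar>N k\<bar> * \<bar>E k\<bar> \<and> \<bar>E' k\<bar> \<le> b * \<bar>E k\<bar> \<and>
       (\<bar>N k\<bar> + \<bar>N' k\<bar>) * (\<bar>E k\<bar> + \<bar>E' k\<bar>) \<le> c"
proof -
  have m': "m \<in> dioph_sym U \<theta>" "star_mag U (err U \<theta> m) = \<nu>"
    and n': "n \<in> dioph_sym U \<theta>" "star_mag U (err U \<theta> n) = \<nu>"
    using m n by (auto simp: dioph_sym_at_def)
  obtain N E a b where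
    N: "m \<in> dioph U \<theta>" "m = star_class U N" "err U \<theta> m = star_class U E" and ab: "a > 0" "b > 0"
    and evm: "\<forall>\<^sub>F k in U. a \<le> \<bar>N k\<bar> * \<bar>E k\<bar> \<and> \<bar>N k\<bar> * \<bar>E k\<bar> \<le> b"
    by (rule dioph_symE[OF U m'(1) m(2)])
  obtain N' E' a' b' where
    N': "n \<in> dioph U \<theta>" "n = star_class U N'" "err U \<theta> n = star_class U E'" and ab': "a' > 0" "b' > 0"
    and evn: "\<forall>\<^sub>F k in U. a' \<le> \<bar>N' k\<bar> * \<bar>E' k\<bar> \<and> \<bar>N' k\<bar> * \<bar>E' k\<bar> \<le> b'"
    by (rule dioph_symE[OF U n'(1) n(2)])
  have "same_order U E E'" using m'(2) n'(2) N(3) N'(3) star_mag_eq_iff[OF U] by metis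
  then obtain p q where pq: "p > 0" "q > 0"
    and evo: "\<forall>\<^sub>F k in U. p * \<bar>E k\<bar> \<le> \<bar>E' k\<bar> \<and> \<bar>E' k\<bar> \<le> q * \<bar>E k\<bar>"
    by (auto simp: same_order_def)
  \<comment> \<open>Here b and b' bound the two diagonal products, while p and q compare the errors;
    the ratio called b in the conclusion is q.\<close>
  have bd: "\<forall>\<^sub>F k in U. a \<le> \<bar>N k\<bar> * \<bar>E k\<bar> \<and> \<bar>E' k\<bar> \<le> q * \<bar>E k\<bar> \<and>
       (\<bar>N k\<bar> + \<bar>N' k\<bar>) * (\<bar>E k\<bar> + \<bar>E' k\<bar>) \<le> (1 + q) * b + (1 + 1/p) * b'"
    using evm evn evo by eventually_elim (use pq in \<open>auto intro!: sum_products_le\<close>)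
  have c: "(1 + q) * b + (1 + 1/p) * b' > 0"
    using ab ab' pq by (intro add_pos_pos mult_pos_pos) auto
  have err: "err U \<theta> (star_add U m n) = star_class U (\<lambda>k. E k + E' k)"
    using dioph_add(2)[OF N(1) N'(1)] unfolding N(3) N'(3) star_map2_class .
  have \<nu>: "star_mag U (star_class U E) = \<nu>" using m'(2) by (simp only: N(3))
  show ?thesis
    by (rule that[OF dioph_add(1)[OF N(1) N'(1)] N(2) N'(2) N(3) N'(3) err \<nu> ab(1) pq(2) c bd])
qed

lemma dioph_sym_at_add_in_dioph_inv:
  assumes U: "ultrafilter U" and m: "m \<in> dioph_sym_at U \<theta> \<nu>" and n: "n \<in> dioph_sym_at U \<theta> \<nu>"
  shows "star_add U m n \<in> dioph_inv U \<theta>"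
proof -
  have inv: "m \<in> dioph_inv U \<theta>" "n \<in> dioph_inv U \<theta>" and sym: "m \<in> dioph_sym U \<theta>" "n \<in> dioph_sym U \<theta>"
    using m n dioph_sym_subset_dioph_inv[OF U] dioph_sym_at_subset_dioph_sym by blast+
  \<comment> \<open>Zero is adjoined to \<open>dioph_sym_at\<close> for every \<nu>, whatever the
    magnitude of its error, so errors can be compared only when both summands are nonzero.\<close>
  consider "m = star_of U 0" | "n = star_of U 0" | "m \<noteq> star_of U 0" "n \<noteq> star_of U 0" by blast
  then show ?thesis
  proof cases
    case 3
    obtain N E N' E' a b c where
      s: "star_add U m n \<in> dioph U \<theta>" "m = star_class U N" "n = star_class U N'"
      and "err U \<theta> m = star_class U E" "err U \<theta> n = star_class U E'"
      and err: "err U \<theta> (star_add U m n) = star_class U (\<lambda>k. E k + E' k)"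
      and "star_mag U (star_class U E) = \<nu>" "a > 0" "b > 0" "c > 0"
      and ev: "\<forall>\<^sub>F k in U. a \<le> \<bar>N k\<bar> * \<bar>E k\<bar> \<and> \<bar>E' k\<bar> \<le> b * \<bar>E k\<bar> \<and>
       (\<bar>N k\<bar> + \<bar>N' k\<bar>) * (\<bar>E k\<bar> + \<bar>E' k\<bar>) \<le> c"
      by (rule dioph_sym_at_pairE[OF U m 3(1) n 3(2)])
    \<comment> \<open>The triangle inequality in both factors reduces this to the bound c; adding 1
      makes the estimate strict, as \<open>dioph_invI\<close> requires.\<close>
    have "\<forall>\<^sub>F k in U. \<bar>N k + N' k\<bar> * \<bar>E k + E' k\<bar> < c + 1"
      using ev
    proof eventually_elim
      case (elim k)
      have "\<bar>N k + N' k\<bar> * \<bar>E k + E' k\<bar> \<le> (\<bar>N k\<bar> + \<bar>N' k\<bar>) * (\<bar>E k\<bar> + \<bar>E' k\<bar>)"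
        by (intro mult_mono) auto
      with elim show ?case by linarith
    qed
    moreover have "star_add U m n = star_class U (\<lambda>k. N k + N' k)"
      by (simp add: s star_map2_class)
    ultimately show ?thesis using dioph_invI[OF U s(1) _ err] by blast
  qed (use inv sym star_add_zero in auto)
qed

section \<open>Absence of cancellation for equal signs\<close>

lemma has_sign_add_class:
  assumes "has_sign U s (star_class U X)" "has_sign U s (star_class U Y)"
  shows "has_sign U s (star_class U (\<lambda>k. X k + Y k))"
    and "\<forall>\<^sub>F k in U. \<bar>X k + Y k\<bar> = \<bar>X k\<bar> + \<bar>Y k\<bar>"
proof -
  show "has_sign U s (star_class U (\<lambda>k. X k + Y k))"
    using assms by (cases s) (auto simp: star_of_def star_rel_class elim: eventually_elim2)
  show "\<forall>\<^sub>F k in U. \<bar>X k + Y k\<bar> = \<bar>X k\<bar> + \<bar>Y k\<bar>"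
    using assms by (cases s) (auto simp: star_of_def star_rel_class elim: eventually_elim2)
qed

lemma has_sign_nonzero:
  assumes "ultrafilter U" "has_sign U s (star_class U X)"
  shows "star_class U X \<noteq> star_of U 0"
proof -
  have "\<forall>\<^sub>F k in U. X k \<noteq> 0"
    using assms by (cases s) (auto simp: star_of_def star_rel_class elim: eventually_mono)
  then show ?thesis
    by (simp add: star_of_def star_class_eq_iff eventually_not_iff_ultrafilter[OF assms(1)])
qed

text \<open>Equal signs make absolute values additive both for the approximations and for their
  errors. The first claim's upper bound is thus complemented by lower bounds, for the product and
  for the error itself.\<close>

lemma dioph_sym_at_signed_add:
  assumes U: "ultrafilter U"
    and m: "m \<in> dioph_sym_at_signed U \<theta> \<nu> \<sigma>" and n: "n \<in> dioph_sym_at_signed U \<theta> \<nu> \<sigma>"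
  shows "star_add U m n \<in> dioph_sym_at_signed U \<theta> \<nu> \<sigma>"
proof -
  have at: "m \<in> dioph_sym_at U \<theta> \<nu>" "n \<in> dioph_sym_at U \<theta> \<nu>"
    using m n by (auto simp: dioph_sym_at_signed_def)
  then have sym: "m \<in> dioph_sym U \<theta>" "n \<in> dioph_sym U \<theta>"
    using dioph_sym_at_subset_dioph_sym by blast+
  consider "m = star_of U 0" | "n = star_of U 0" | "m \<noteq> star_of U 0" "n \<noteq> star_of U 0" by blast
  then show ?thesis
  proof cases
    case 3
    obtain N E N' E' a b c where
      s: "star_add U m n \<in> dioph U \<theta>" and N: "m = star_class U N" "n = star_class U N'"
      and E: "err U \<theta> m = star_class U E" "err U \<theta> n = star_class U E'"
      and err: "err U \<theta> (star_add U m n) = star_class U (\<lambda>k. E k + E' k)"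
      and \<nu>: "star_mag U (star_class U E) = \<nu>" and abc: "a > 0" "b > 0" "c > 0"
      and ev: "\<forall>\<^sub>F k in U. a \<le> \<bar>N k\<bar> * \<bar>E k\<bar> \<and> \<bar>E' k\<bar> \<le> b * \<bar>E k\<bar> \<and>
       (\<bar>N k\<bar> + \<bar>N' k\<bar>) * (\<bar>E k\<bar> + \<bar>E' k\<bar>) \<le> c"
      by (rule dioph_sym_at_pairE[OF U at(1) 3(1) at(2) 3(2)])
    have sum: "star_add U m n = star_class U (\<lambda>k. N k + N' k)"
      by (simp add: N star_map2_class)
    have sg: "has_sign U (fst \<sigma>) m" "has_sign U (fst \<sigma>) n"
      "has_sign U (snd \<sigma>) (err U \<theta> m)" "has_sign U (snd \<sigma>) (err U \<theta> n)"
      using m n 3 by (auto simp: dioph_sym_at_signed_def dioph_signed_def)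
    note sgN = has_sign_add_class[OF sg(1,2)[unfolded N]]
      and sgE = has_sign_add_class[OF sg(3,4)[unfolded E]]
    \<comment> \<open>Without cancellation the product equals (\<bar>N\<bar> + \<bar>N'\<bar>) *
      (\<bar>E\<bar> + \<bar>E'\<bar>), which is at most c and dominates \<bar>N\<bar> *
      \<bar>E\<bar>, hence a.\<close>
    have "\<forall>\<^sub>F k in U. a \<le> \<bar>N k + N' k\<bar> * \<bar>E k + E' k\<bar> \<and> \<bar>N k + N' k\<bar> * \<bar>E k + E' k\<bar> \<le> c"
      using ev sgN(2) sgE(2)
    proof eventually_elim
      case (elim k)
      have "\<bar>N k\<bar> * \<bar>E k\<bar> \<le> (\<bar>N k\<bar> + \<bar>N' k\<bar>) * (\<bar>E k\<bar> + \<bar>E' k\<bar>)"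
        by (intro mult_mono) auto
      with elim show ?case by simp
    qed
    then have "star_class U (\<lambda>k. \<bar>N k + N' k\<bar> * \<bar>E k + E' k\<bar>) \<in> star_fin U - star_eps U"
      using abc star_class_appreciable_iff[OF U, of "\<lambda>k. \<bar>N k + N' k\<bar> * \<bar>E k + E' k\<bar>"]
      by (auto simp: abs_mult)
    then have "star_mult U (star_abs U (star_add U m n)) (star_abs U (err U \<theta> (star_add U m n)))
        \<in> star_fin U - star_eps U"
      unfolding err unfolding sum by (simp add: star_map_class star_map2_class)
    moreover have "star_add U m n \<noteq> star_of U 0"
      unfolding sum by (rule has_sign_nonzero[OF U sgN(1)])
    ultimately have "star_add U m n \<in> dioph_sym U \<theta>"
      using s by (simp add: dioph_sym_def)
    \<comment> \<open>The factor 1 comes from \<bar>E + E'\<bar> = \<bar>E\<bar> + \<bar>E'\<bar>,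
      the factor 1 + b from \<bar>E'\<bar> \<le> b * \<bar>E\<bar>. So the summed error still has
      magnitude \<nu>.\<close>
    moreover have "\<forall>\<^sub>F k in U. 1 * \<bar>E k\<bar> \<le> \<bar>E k + E' k\<bar> \<and> \<bar>E k + E' k\<bar> \<le> (1 + b) * \<bar>E k\<bar>"
      using ev sgE(2) by eventually_elim (simp add: algebra_simps)
    then have "same_order U E (\<lambda>k. E k + E' k)"
      unfolding same_order_def using abc by (intro exI[of _ 1] exI[of _ "1 + b"] conjI) auto
    then have "star_mag U (err U \<theta> (star_add U m n)) = \<nu>"
      unfolding err using star_mag_eq_iff[OF U] \<nu> by metis
    moreover have "star_add U m n \<in> dioph_signed U \<theta> \<sigma>"
      using s sgN(1) sgE(1) unfolding dioph_signed_def err[symmetric] sum[symmetric] by simp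
    ultimately show ?thesis by (simp add: dioph_sym_at_signed_def dioph_sym_at_def)
  qed (use m n sym star_add_zero in auto)
qed

section \<open>The monoid structure and the final statement\<close>

lemma monoid_dioph_sym_at_signed:
  assumes U: "ultrafilter U"
  shows "monoid \<lparr>carrier = dioph_sym_at_signed U \<theta> \<nu> \<sigma>,
                 monoid.mult = star_add U, one = star_of U 0\<rparr>"
proof -
  have sym: "x \<in> dioph_sym U \<theta>" if "x \<in> dioph_sym_at_signed U \<theta> \<nu> \<sigma>" for x
    using that dioph_sym_at_subset_dioph_sym by (auto simp: dioph_sym_at_signed_def)
  have "star_add U (star_add U x y) z = star_add U x (star_add U y z)"
    if "x \<in> dioph_sym U \<theta>" "y \<in> dioph_sym U \<theta>" "z \<in> dioph_sym U \<theta>" for x y z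
    using that[THEN star_class_if_dioph_sym] by (auto simp: star_map2_class add.assoc)
  moreover have "star_of U 0 \<in> dioph_sym_at_signed U \<theta> \<nu> \<sigma>"
    by (simp add: dioph_sym_at_signed_def dioph_sym_at_def dioph_signed_def)
  ultimately show ?thesis
    by (intro monoidI) (simp_all add: sym star_add_zero[OF sym] dioph_sym_at_signed_add[OF U])
qed

theorem theorem19:
  fixes U :: "nat filter" and \<theta> :: real
  assumes "nonprincipal_ultrafilter U"
  shows "(\<forall>\<nu> \<in> star_P_eps U.
            star_sumset U (dioph_sym_at U \<theta> \<nu>) (dioph_sym_at U \<theta> \<nu>) \<subseteq> dioph_inv U \<theta>) \<and>
         (\<forall>\<sigma>. \<sigma> = (Pos, Pos) \<or> \<sigma> = (Neg, Neg) \<longrightarrow>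
            (\<forall>\<nu> \<in> star_P_eps U.
               monoid \<lparr>carrier = dioph_sym_at_signed U \<theta> \<nu> \<sigma>,
                       monoid.mult = star_add U, one = star_of U 0\<rparr> \<and>
               star_sumset U (dioph_sym_at_signed U \<theta> \<nu> \<sigma>) (dioph_sym_at_signed U \<theta> \<nu> \<sigma>)
                 \<subseteq> dioph_sym_at_signed U \<theta> \<nu> \<sigma>))"
proof -
  have U: "ultrafilter U" using assms by (simp add: nonprincipal_ultrafilter_def)
  show ?thesis
    using dioph_sym_at_add_in_dioph_inv[OF U] dioph_sym_at_signed_add[OF U]
      monoid_dioph_sym_at_signed[OF U]
    by (auto simp: star_sumset_def)
qed

end
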